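(* Every initialized play-once $n$-person graphical game has, under the a-priori realization, a Nash equilibrium in mixed strategies (equivalently, since the game is play-once, in stationary mixed strategies).
   Context: An initialized graphical game of $n$ players $I=\{1,\dots,n\}$ consists of: a finite directed graph $G=(V,E)$ (vertices are positions, arcs are moves); a partition $V=V_1\cup\dots\cup V_n\cup V_R\cup V_T$, where $V_T$ is the set of terminal positions (those with no outgoing arcs), $V_R$ is the set of positions of chance, and $V_i$ is the set of positions controlled by player $i$; for each $v\in V_R$ a fixed probability distribution $q(v)$ on the arcs going out of $v$; an initial position $v_0\in V\setminus V_T$; and a payoff $u:I\times A\to\mathbb{R}$, where $A=V_T\cup\{c\}$ is the set of outcomes (each terminal is an outcome and all infinite plays form the single outcome $c$). The game is play-once if $|V_i|=1$ for all $i\in I$. A (stationary) mixed strategy of player $i$ in a play-once game is a probability distribution on the arcs going out of the unique position of $V_i$. Under the a-priori realization, before the play begins one move is drawn, independently, in every non-terminal position, according to $q(v)$ for $v\in V_R$ and according to the controlling player's strategy for $v\in V_1\cup\dots\cup V_n$; the play then starts in $v_0$ and follows these fixed moves (the same move is repeated whenever a position is revisited), so it either ends in a terminal $a\in V_T$ (outcome $a$) or repeats a directed cycle forever (outcome $c$). The expected payoff of player $i$ is the expectation of $u_i$ of the resulting outcome. A Nash equilibrium is a tuple of strategies, one for each player, such that no player can strictly increase his expected payoff by changing only his own strategy. *)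

theory Defs
  imports "HOL-Probability.Probability" "HOL-Probability.Product_PMF" "Graph_Theory.Digraph"
begin

text \<open>Outcomes of a play: \<^term>\<open>Terminal a\<close> for a terminal position \<^term>\<open>a\<close>, and the single
  outcome \<^term>\<open>Cycling\<close> (written \<open>c\<close> in the literature) shared by all infinite plays.\<close>

datatype 'v outcome = Terminal 'v | Cycling

text \<open>The players are \<open>1, \<dots>, num_players\<close>; the values of \<open>controlled\<close> and \<open>payoff\<close> at other
  indices, and of \<open>chance_dist\<close> outside \<open>chance\<close>, are never used.\<close>

record ('v, 'e) game =
  graph :: "('v, 'e) pre_digraph"
  num_players :: nat
  controlled :: "nat \<Rightarrow> 'v set"
  chance :: "'v set"
  chance_dist :: "'v \<Rightarrow> 'e pmf"
  initial :: 'v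
  payoff :: "nat \<Rightarrow> 'v outcome \<Rightarrow> real"

definition players :: "('v, 'e) game \<Rightarrow> nat set" where
  "players \<Gamma> = {1..num_players \<Gamma>}"

definition terminals :: "('v, 'e) game \<Rightarrow> 'v set" where
  "terminals \<Gamma> = {v \<in> verts (graph \<Gamma>). out_arcs (graph \<Gamma>) v = {}}"

text \<open>Loops and parallel arcs are allowed. Blocks of the partition may be empty.\<close>

definition graphical_game :: "('v, 'e) game \<Rightarrow> bool" where
  "graphical_game \<Gamma> \<longleftrightarrow>
     fin_digraph (graph \<Gamma>) \<and>
     verts (graph \<Gamma>) = (\<Union>i\<in>players \<Gamma>. controlled \<Gamma> i) \<union> chance \<Gamma> \<union> terminals \<Gamma> \<and>
     disjoint_family_on (controlled \<Gamma>) (players \<Gamma>) \<and>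
     (\<forall>i\<in>players \<Gamma>. controlled \<Gamma> i \<inter> chance \<Gamma> = {} \<and> controlled \<Gamma> i \<inter> terminals \<Gamma> = {}) \<and>
     chance \<Gamma> \<inter> terminals \<Gamma> = {} \<and>
     (\<forall>v\<in>chance \<Gamma>. set_pmf (chance_dist \<Gamma> v) \<subseteq> out_arcs (graph \<Gamma>) v) \<and>
     initial \<Gamma> \<in> verts (graph \<Gamma>) - terminals \<Gamma>"

definition play_once :: "('v, 'e) game \<Rightarrow> bool" where
  "play_once \<Gamma> \<longleftrightarrow> (\<forall>i\<in>players \<Gamma>. card (controlled \<Gamma> i) = 1)"

text \<open>Mixed strategies and strategy profiles are only meaningful for play-once games, where
  \<^term>\<open>the_elem (controlled \<Gamma> i)\<close> is the unique position of player \<^term>\<open>i\<close>.\<close>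

definition mixed_strategy :: "('v, 'e) game \<Rightarrow> nat \<Rightarrow> 'e pmf \<Rightarrow> bool" where
  "mixed_strategy \<Gamma> i p \<longleftrightarrow> set_pmf p \<subseteq> out_arcs (graph \<Gamma>) (the_elem (controlled \<Gamma> i))"

definition controller :: "('v, 'e) game \<Rightarrow> 'v \<Rightarrow> nat" where
  "controller \<Gamma> v = (THE i. i \<in> players \<Gamma> \<and> v \<in> controlled \<Gamma> i)"

definition move_dist :: "('v, 'e) game \<Rightarrow> (nat \<Rightarrow> 'e pmf) \<Rightarrow> 'v \<Rightarrow> 'e pmf" where
  "move_dist \<Gamma> s v = (if v \<in> chance \<Gamma> then chance_dist \<Gamma> v else s (controller \<Gamma> v))"

text \<open>The a-priori realization: one move is drawn independently in every non-terminal position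
  before the play begins.\<close>

definition apriori_moves :: "('v, 'e) game \<Rightarrow> (nat \<Rightarrow> 'e pmf) \<Rightarrow> ('v \<Rightarrow> 'e) pmf" where
  "apriori_moves \<Gamma> s = Pi_pmf (verts (graph \<Gamma>) - terminals \<Gamma>) undefined (move_dist \<Gamma> s)"

text \<open>The play that follows fixed moves \<^term>\<open>\<sigma>\<close>, as an infinite sequence of positions that
  stays put once it has reached a terminal position.\<close>

definition step :: "('v, 'e) game \<Rightarrow> ('v \<Rightarrow> 'e) \<Rightarrow> 'v \<Rightarrow> 'v" where
  "step \<Gamma> \<sigma> v = (if v \<in> terminals \<Gamma> then v else head (graph \<Gamma>) (\<sigma> v))"

definition play :: "('v, 'e) game \<Rightarrow> ('v \<Rightarrow> 'e) \<Rightarrow> nat \<Rightarrow> 'v" where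
  "play \<Gamma> \<sigma> k = (step \<Gamma> \<sigma> ^^ k) (initial \<Gamma>)"

definition play_outcome :: "('v, 'e) game \<Rightarrow> ('v \<Rightarrow> 'e) \<Rightarrow> 'v outcome" where
  "play_outcome \<Gamma> \<sigma> =
     (if \<exists>k. play \<Gamma> \<sigma> k \<in> terminals \<Gamma>
      then Terminal (play \<Gamma> \<sigma> (LEAST k. play \<Gamma> \<sigma> k \<in> terminals \<Gamma>))
      else Cycling)"

definition expected_payoff :: "('v, 'e) game \<Rightarrow> (nat \<Rightarrow> 'e pmf) \<Rightarrow> nat \<Rightarrow> real" where
  "expected_payoff \<Gamma> s i =
     measure_pmf.expectation (map_pmf (play_outcome \<Gamma>) (apriori_moves \<Gamma> s)) (payoff \<Gamma> i)"

definition nash_equilibrium :: "('v, 'e) game \<Rightarrow> (nat \<Rightarrow> 'e pmf) \<Rightarrow> bool" where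
  "nash_equilibrium \<Gamma> s \<longleftrightarrow>
     (\<forall>i\<in>players \<Gamma>. mixed_strategy \<Gamma> i (s i)) \<and>
     (\<forall>i\<in>players \<Gamma>. \<forall>p. mixed_strategy \<Gamma> i p \<longrightarrow>
        \<not> expected_payoff \<Gamma> (s(i := p)) i > expected_payoff \<Gamma> s i)"

end

(* Under the a-priori realization the moves are independent, so for every payoff function the
   expectation is a polynomial in the move probabilities, affine in each position's distribution.
   A play-once game is therefore a finite game in normal form with a nature player, and Nash's
   argument applies: the map p_a -> (p_a + gain_a) / (1 + sum of gains) has a fixed point, at which
   all gains vanish. Since the dimension depends on the game and not on a type, Brouwer's theorem is
   derived for cubes over a finite index set from Kuhn's combinatorial lemma. *)
theory Submission
  imports Defs
begin

section \<open>Brouwer's fixed point theorem on finite-dimensional cubes\<close>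

text \<open>Bolzano-Weierstrass, one coordinate at a time: a further subsequence settles the new
  coordinate and keeps the limits already found.\<close>

lemma finite_coordinates_convergent_subsequence:
  fixes X :: "nat \<Rightarrow> 'a \<Rightarrow> real"
  assumes "finite I" "\<And>k i. i \<in> I \<Longrightarrow> X k i \<in> {0..1}"
  shows "\<exists>l r. strict_mono r \<and> (\<forall>i\<in>I. (\<lambda>k. X (r k) i) \<longlonglongrightarrow> l i)"
  using assms
proof (induction I rule: finite_induct)
  case empty
  show ?case using strict_mono_id by blast
next
  case (insert j I)
  then obtain l r where r: "strict_mono r" and l: "\<forall>i\<in>I. (\<lambda>k. X (r k) i) \<longlonglongrightarrow> l i"
    by auto
  have "seq_compact {0..1::real}"
    by (simp add: compact_imp_seq_compact)
  then obtain m t where t: "strict_mono t" and m: "((\<lambda>k. X (r k) j) \<circ> t) \<longlonglongrightarrow> m"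
    using insert.prems by (metis (no_types, lifting) insertI1 seq_compactE)
  have "(\<lambda>k. X ((r \<circ> t) k) i) \<longlonglongrightarrow> (l(j := m)) i" if "i \<in> insert j I" for i
  proof (cases "i = j")
    case True
    then show ?thesis using m by (simp add: o_def)
  next
    case False
    then show ?thesis
      using LIMSEQ_subseq_LIMSEQ[OF _ t, of "\<lambda>k. X (r k) i" "l i"] l that by (simp add: o_def)
  qed
  then show ?case using strict_mono_o[OF r t] by blast
qed

text \<open>Grid points are labelled by the direction in which \<open>f\<close> moves each
  coordinate. Kuhn's lemma yields ever smaller cells in which every coordinate shows both labels; a
  limit point of these cells is fixed by continuity.\<close>

lemma brouwer_finite_cube:
  fixes f :: "('a \<Rightarrow> real) \<Rightarrow> 'a \<Rightarrow> real"
  assumes fin: "finite I"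
    and maps: "\<And>x i. x \<in> Pi I (\<lambda>_. {0..1}) \<Longrightarrow> i \<in> I \<Longrightarrow> f x i \<in> {0..1}"
    and cont: "\<And>i. i \<in> I \<Longrightarrow> continuous_on (Pi I (\<lambda>_. {0..1})) (\<lambda>x. f x i)"
  shows "\<exists>x \<in> Pi I (\<lambda>_. {0..1}). \<forall>i\<in>I. f x i = x i"
proof -
  let ?C = "Pi I (\<lambda>_. {0..1::real})"
  define n where "n = card I"
  \<comment> \<open>Kuhn's lemma speaks of grid points with coordinates \<open>j < n\<close>;
    \<open>e\<close> and \<open>d\<close> translate between these and \<open>I\<close>.\<close>
  obtain e where e: "bij_betw e {..<n} I"
    using fin ex_bij_betw_nat_finite[OF fin] by (auto simp: n_def atLeast0LessThan)
  define d where "d = inv_into {..<n} e"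
  have d: "d i < n" "e (d i) = i" if "i \<in> I" for i
    using bij_betwE[OF bij_betw_inv_into[OF e]] that bij_betw_inv_into_right[OF e that]
    by (auto simp: d_def)
  \<comment> \<open>The grid has mesh \<open>1 / Suc p\<close>, so \<open>p = 0\<close> is harmless.
    The value 0 off \<open>I\<close> makes convergence in the full product topology a matter of the
    coordinates in \<open>I\<close>.\<close>
  define pt where "pt p g = (\<lambda>i. if i \<in> I then real (g (d i)) / real (Suc p) else 0)" for p g
  have pt_C: "pt p g \<in> ?C" if "\<forall>j<n. g j \<le> Suc p" for p g
    using that d by (auto simp: pt_def Pi_iff simp del: of_nat_Suc)
  \<comment> \<open>Kuhn's lemma prescribes label 0 on the lower faces and 1 on the upper ones.
    Since \<open>f\<close> maps into the cube, these forced labels still agree with the weak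
    inequalities \<open>label0\<close> and \<open>label1\<close>.\<close>
  define label :: "nat \<Rightarrow> (nat \<Rightarrow> nat) \<Rightarrow> nat \<Rightarrow> nat" where
    "label p g j = (if g j = Suc p \<or> (g j \<noteq> 0 \<and> f (pt p g) (e j) < pt p g (e j)) then 1 else 0)"
    for p g j
  have label_bin: "label p g j = 0 \<or> label p g j = 1" for p g j
    by (simp add: label_def)
  have label0: "pt p g i \<le> f (pt p g) i" if "i \<in> I" "\<forall>j<n. g j \<le> Suc p" "label p g (d i) = 0" for p g i
    using that maps[OF pt_C[OF that(2)] that(1)] d[OF that(1)]
    by (cases "g (d i) = 0") (auto simp: label_def pt_def split: if_splits)
  have label1: "f (pt p g) i \<le> pt p g i" if "i \<in> I" "\<forall>j<n. g j \<le> Suc p" "label p g (d i) \<noteq> 0" for p g i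
    using that maps[OF pt_C[OF that(2)] that(1)] d[OF that(1)]
    by (cases "g (d i) = Suc p") (auto simp: label_def pt_def simp del: of_nat_Suc split: if_splits)
  define near :: "(nat \<Rightarrow> nat) \<Rightarrow> (nat \<Rightarrow> nat) \<Rightarrow> bool" where
    "near q g \<longleftrightarrow> (\<forall>j<n. q j \<le> g j \<and> g j \<le> q j + 1)" for q g
  define opposite where
    "opposite p q i r s \<longleftrightarrow> near q r \<and> near q s \<and> label p r (d i) = 0 \<and> label p s (d i) \<noteq> 0"
    for p q i r s
  have "\<exists>q. (\<forall>j<n. q j < Suc p) \<and> (\<forall>i\<in>I. \<exists>r s. opposite p q i r s)" for p
  proof -
    obtain q where q: "\<forall>j<n. q j < Suc p" and
      rs: "\<forall>i<n. \<exists>r s. (\<forall>j<n. q j \<le> r j \<and> r j \<le> q j + 1) \<and> (\<forall>j<n. q j \<le> s j \<and> s j \<le> q j + 1)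
        \<and> label p r i \<noteq> label p s i"
      by (rule kuhn_lemma[of "Suc p" n "label p"]) (auto simp: label_def)
    have "\<exists>r s. opposite p q i r s" if i: "i \<in> I" for i
    proof -
      obtain r s where near: "near q r" "near q s" and neq: "label p r (d i) \<noteq> label p s (d i)"
        using rs[rule_format, OF d(1)[OF i]] unfolding near_def by (elim exE conjE)
      consider "label p r (d i) = 0" "label p s (d i) \<noteq> 0"
        | "label p s (d i) = 0" "label p r (d i) \<noteq> 0"
        using neq label_bin[of p r "d i"] label_bin[of p s "d i"] by linarith
      then have "opposite p q i r s \<or> opposite p q i s r"
        using near unfolding opposite_def by cases simp_all
      then show ?thesis by blast
    qed
    then show ?thesis using q by (intro exI[of _ q] conjI) simp_all
  qed
  then have "\<exists>q. \<forall>p. (\<forall>j<n. q p j < Suc p) \<and> (\<forall>i\<in>I. \<exists>r s. opposite p (q p) i r s)"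
    by (intro choice allI)
  then obtain q where q': "\<forall>p. (\<forall>j<n. q p j < Suc p) \<and> (\<forall>i\<in>I. \<exists>r s. opposite p (q p) i r s)"
    by (elim exE)
  have q: "q p j < Suc p" if "j < n" for p j
    using q' that by simp
  \<comment> \<open>\<open>r p i\<close> is a corner of the \<open>p\<close>-th cell with label 0 in
    coordinate \<open>i\<close>, and \<open>s p i\<close> one with label 1.\<close>
  define r where "r p i = (SOME r. \<exists>s. opposite p (q p) i r s)" for p i
  define s where "s p i = (SOME s. opposite p (q p) i (r p i) s)" for p i
  have "opposite p (q p) i (r p i) (s p i)" if "i \<in> I" for p i
  proof -
    have "\<exists>r s. opposite p (q p) i r s"
      using q' that by simp
    from someI_ex[OF this] have "\<exists>s. opposite p (q p) i (r p i) s"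
      unfolding r_def .
    then show ?thesis
      unfolding s_def by (rule someI_ex)
  qed
  then have r: "\<And>p i. i \<in> I \<Longrightarrow> near (q p) (r p i)" and s: "\<And>p i. i \<in> I \<Longrightarrow> near (q p) (s p i)"
    and lr: "\<And>p i. i \<in> I \<Longrightarrow> label p (r p i) (d i) = 0"
    and ls: "\<And>p i. i \<in> I \<Longrightarrow> label p (s p i) (d i) \<noteq> 0"
    unfolding opposite_def by simp_all
  \<comment> \<open>Cells shrink along a subsequence to a point, where both label inequalities survive in the limit;
    this replaces the usual uniform continuity estimate.\<close>
  obtain l t where t: "strict_mono t" and l: "\<And>i. i \<in> I \<Longrightarrow> (\<lambda>k. pt (t k) (q (t k)) i) \<longlonglongrightarrow> l i"
  proof -
    have "pt p (q p) i \<in> {0..1}" if "i \<in> I" for p i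
      using pt_C[of "q p" p] q that by (auto simp: less_imp_le)
    from finite_coordinates_convergent_subsequence[OF fin, of "\<lambda>p. pt p (q p)", OF this] show thesis
      using that by auto
  qed
  define x where "x i = (if i \<in> I then l i else 0)" for i
  have xC: "x \<in> ?C"
  proof
    fix i assume i: "i \<in> I"
    have "pt (t k) (q (t k)) i \<in> {0..1}" for k
      using pt_C[of "q (t k)" "t k"] q i by (auto simp: less_imp_le)
    then show "x i \<in> {0..1}"
      using LIMSEQ_le_const[OF l[OF i], of 0] LIMSEQ_le_const2[OF l[OF i], of 1] i
      by (auto simp: x_def)
  qed
  \<comment> \<open>Corners differ from the base corner by at most one mesh width per coordinate, so
    every choice of corners has the same limit.\<close>
  have neighbour: "(\<lambda>k. pt (t k) (g k)) \<longlonglongrightarrow> x"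
    if g: "\<And>k. near (q (t k)) (g k)" for g
  proof -
    have "(\<lambda>k. pt (t k) (g k) i) \<longlonglongrightarrow> x i" for i
    proof (cases "i \<in> I")
      case True
      have "(\<lambda>k. 1 / real (Suc (t k))) \<longlonglongrightarrow> 0"
        using LIMSEQ_subseq_LIMSEQ[OF lim_1_over_n[THEN LIMSEQ_Suc] t] by (simp add: o_def)
      from tendsto_add[OF l[OF True] this]
      have up: "(\<lambda>k. pt (t k) (q (t k)) i + 1 / real (Suc (t k))) \<longlonglongrightarrow> l i" by simp
      have "real (q (t k) (d i)) \<le> real (g k (d i))"
        "real (g k (d i)) \<le> real (q (t k) (d i)) + 1" for k
        using g[of k] d(1)[OF True] by (auto simp: near_def)
      then have "pt (t k) (q (t k)) i \<le> pt (t k) (g k) i"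
        "pt (t k) (g k) i \<le> pt (t k) (q (t k)) i + 1 / real (Suc (t k))" for k
        using True by (auto simp: pt_def divide_simps simp del: of_nat_Suc)
      then have "(\<lambda>k. pt (t k) (g k) i) \<longlonglongrightarrow> l i"
        by (intro real_tendsto_sandwich[OF _ _ l[OF True] up]) auto
      then show ?thesis using True by (simp add: x_def)
    qed (simp add: pt_def x_def)
    then show ?thesis
      using limitin_componentwise[of "\<lambda>_. euclidean" UNIV "\<lambda>k. pt (t k) (g k)" x sequentially]
      by (simp add: euclidean_product_topology)
  qed
  have "f x i = x i" if i: "i \<in> I" for i
  proof (rule antisym)
    have near_C: "\<forall>j<n. g j \<le> Suc (t k)" if "near (q (t k)) g" for g k
      using that q[of _ "t k"] unfolding near_def
      by (metis Suc_eq_plus1 Suc_leI le_trans)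
    note rC = near_C[OF r[OF i]] and sC = near_C[OF s[OF i]]
    have lim: "(\<lambda>k. f (pt (t k) (g k)) i) \<longlonglongrightarrow> f x i" "(\<lambda>k. pt (t k) (g k) i) \<longlonglongrightarrow> x i"
      if "(\<lambda>k. pt (t k) (g k)) \<longlonglongrightarrow> x" "\<And>k. \<forall>j<n. g k j \<le> Suc (t k)" for g
    proof -
      show "(\<lambda>k. f (pt (t k) (g k)) i) \<longlonglongrightarrow> f x i"
        by (intro continuous_on_tendsto_compose[OF cont[OF i] that(1) xC] always_eventually)
           (use pt_C that(2) in blast)
      show "(\<lambda>k. pt (t k) (g k) i) \<longlonglongrightarrow> x i"
        using that(1) by (intro continuous_on_tendsto_compose[OF continuous_on_product_coordinates, of _ x]) auto
    qed
    show "x i \<le> f x i"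
      using lim[OF neighbour, of "\<lambda>k. r (t k) i", OF r[OF i] rC] label0[OF i rC lr[OF i]]
      by (intro LIMSEQ_le[of "\<lambda>k. pt (t k) (r (t k) i) i"]) auto
    show "f x i \<le> x i"
      using lim[OF neighbour, of "\<lambda>k. s (t k) i", OF s[OF i] sC] label1[OF i sC ls[OF i]]
      by (intro LIMSEQ_le[of _ _ "\<lambda>k. pt (t k) (s (t k) i) i"]) auto
  qed
  then show ?thesis using xC by blast
qed

section \<open>Expectations under finite product distributions\<close>

text \<open>Summing over the fixed finite sets \<open>A v\<close> rather than the supports gives one
  polynomial in the probabilities, valid for all such \<open>m\<close>.\<close>

lemma expectation_Pi_pmf_eq_sum:
  fixes g :: "('i \<Rightarrow> 'a) \<Rightarrow> real"
  assumes "finite D" "\<And>v. v \<in> D \<Longrightarrow> finite (A v)" "\<And>v. v \<in> D \<Longrightarrow> set_pmf (m v) \<subseteq> A v"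
  shows "measure_pmf.expectation (Pi_pmf D d m) g =
    (\<Sum>\<sigma>\<in>PiE_dflt D d A. (\<Prod>v\<in>D. pmf (m v) (\<sigma> v)) * g \<sigma>)"
proof -
  have "measure_pmf.expectation (Pi_pmf D d m) g =
      (\<Sum>\<sigma>\<in>PiE_dflt D d A. g \<sigma> * pmf (Pi_pmf D d m) \<sigma>)"
    using assms set_Pi_pmf_subset'[OF assms(1), of d m]
    by (intro integral_measure_pmf_real finite_PiE_dflt) (fastforce simp: PiE_dflt_def)+
  also have "\<dots> = (\<Sum>\<sigma>\<in>PiE_dflt D d A. (\<Prod>v\<in>D. pmf (m v) (\<sigma> v)) * g \<sigma>)"
    using assms(1) by (intro sum.cong refl) (auto simp: pmf_Pi' PiE_dflt_def)
  finally show ?thesis .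
qed

lemma continuous_on_expectation_Pi_pmf:
  fixes g :: "('i \<Rightarrow> 'a) \<Rightarrow> real" and m :: "'x::topological_space \<Rightarrow> 'i \<Rightarrow> 'a pmf"
  assumes "finite D" "\<And>v. v \<in> D \<Longrightarrow> finite (A v)"
    and "\<And>v x. v \<in> D \<Longrightarrow> x \<in> C \<Longrightarrow> set_pmf (m x v) \<subseteq> A v"
    and "\<And>v a. v \<in> D \<Longrightarrow> continuous_on C (\<lambda>x. pmf (m x v) a)"
  shows "continuous_on C (\<lambda>x. measure_pmf.expectation (Pi_pmf D d (m x)) g)"
proof -
  have "continuous_on C (\<lambda>x. \<Sum>\<sigma>\<in>PiE_dflt D d A. (\<Prod>v\<in>D. pmf (m x v) (\<sigma> v)) * g \<sigma>)"
    by (intro continuous_intros assms(4))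
  then show ?thesis
    using expectation_Pi_pmf_eq_sum[OF assms(1,2,3)] by (auto cong: continuous_on_cong)
qed

text \<open>The factor of \<open>i\<close> splits off each product, so the expectation is linear in
  \<open>p\<close>; point masses recover the coefficients.\<close>

lemma expectation_Pi_pmf_upd:
  fixes g :: "('i \<Rightarrow> 'a) \<Rightarrow> real"
  assumes fin: "finite D" "\<And>v. v \<in> D \<Longrightarrow> finite (A v)"
    and m: "\<And>v. v \<in> D \<Longrightarrow> set_pmf (m v) \<subseteq> A v"
    and i: "i \<in> D" and p: "set_pmf p \<subseteq> A i"
  shows "measure_pmf.expectation (Pi_pmf D d (m(i := p))) g =
    (\<Sum>a\<in>A i. pmf p a * measure_pmf.expectation (Pi_pmf D d (m(i := return_pmf a))) g)"
proof -
  \<comment> \<open>The part of each summand that does not depend on the distribution at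
    \<open>i\<close>.\<close>
  define R where "R \<sigma> = (\<Prod>v\<in>D - {i}. pmf (m v) (\<sigma> v)) * g \<sigma>" for \<sigma>
  have E: "measure_pmf.expectation (Pi_pmf D d (m(i := p'))) g =
      (\<Sum>\<sigma>\<in>PiE_dflt D d A. pmf p' (\<sigma> i) * R \<sigma>)" if "set_pmf p' \<subseteq> A i" for p'
  proof -
    have "(\<Prod>v\<in>D. pmf ((m(i := p')) v) (\<sigma> v)) * g \<sigma> = pmf p' (\<sigma> i) * R \<sigma>" for \<sigma>
      by (simp add: prod.remove[OF fin(1) i] R_def mult.assoc)
    then show ?thesis
      using m that by (subst expectation_Pi_pmf_eq_sum[OF fin]) auto
  qed
  have "(\<Sum>a\<in>A i. pmf p a * measure_pmf.expectation (Pi_pmf D d (m(i := return_pmf a))) g) =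
      (\<Sum>a\<in>A i. \<Sum>\<sigma>\<in>PiE_dflt D d A. pmf p a * (pmf (return_pmf a) (\<sigma> i) * R \<sigma>))"
    by (intro sum.cong refl) (simp add: E sum_distrib_left)
  also have "\<dots> = (\<Sum>\<sigma>\<in>PiE_dflt D d A. \<Sum>a\<in>A i. pmf p a * (pmf (return_pmf a) (\<sigma> i) * R \<sigma>))"
    by (rule sum.swap)
  also have "\<dots> = (\<Sum>\<sigma>\<in>PiE_dflt D d A. pmf p (\<sigma> i) * R \<sigma>)"
  proof (intro sum.cong refl)
    fix \<sigma> assume "\<sigma> \<in> PiE_dflt D d A"
    then have "\<sigma> i \<in> A i" using i by (auto simp: PiE_dflt_def)
    have "(\<Sum>a\<in>A i. pmf p a * (pmf (return_pmf a) (\<sigma> i) * R \<sigma>)) =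
        (\<Sum>a\<in>A i. if a = \<sigma> i then pmf p a * R \<sigma> else 0)"
      by (intro sum.cong) (auto simp: indicator_def)
    also have "\<dots> = pmf p (\<sigma> i) * R \<sigma>"
      using fin(2)[OF i] \<open>\<sigma> i \<in> A i\<close> by simp
    finally show "(\<Sum>a\<in>A i. pmf p a * (pmf (return_pmf a) (\<sigma> i) * R \<sigma>)) = pmf p (\<sigma> i) * R \<sigma>" .
  qed
  finally show ?thesis using E[OF p] by simp
qed

section \<open>Nash's theorem for a finite game with nature\<close>

text \<open>\<open>N\<close> is the set of strategic positions; those in \<open>D - N\<close> move at random according to \<open>q\<close>.\<close>

lemma mixed_equilibrium_exists:
  fixes A :: "'i \<Rightarrow> 'a set" and u :: "'i \<Rightarrow> ('i \<Rightarrow> 'a) \<Rightarrow> real"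
    and q :: "'i \<Rightarrow> 'a pmf" and d :: 'a
  assumes finD: "finite D" and ND: "N \<subseteq> D"
    and finA: "\<And>i. i \<in> D \<Longrightarrow> finite (A i)"
    and ne: "\<And>i. i \<in> N \<Longrightarrow> A i \<noteq> {}"
    and q: "\<And>i. i \<in> D - N \<Longrightarrow> set_pmf (q i) \<subseteq> A i"
  defines "V \<equiv> \<lambda>s i. measure_pmf.expectation (Pi_pmf D d (override_on q s N)) (u i)"
  shows "\<exists>s. (\<forall>i\<in>N. set_pmf (s i) \<subseteq> A i) \<and>
    (\<forall>i\<in>N. \<forall>p. set_pmf p \<subseteq> A i \<longrightarrow> V (s(i := p)) i \<le> V s i)"
proof -
  \<comment> \<open>One coordinate for each pair of a strategic position and an action, so that
    Brouwer's theorem for cubes applies.\<close>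
  define C where "C = Pi (Sigma N A) (\<lambda>_. {0..1::real})"
  define T where "T x i = (\<Sum>a\<in>A i. x (i, a))" for x :: "'i \<times> 'a \<Rightarrow> real" and i
  \<comment> \<open>Retracts the cube onto the product of simplices: adding the deficit makes the coordinate sum
    at least 1, so the normalization never divides by 0.\<close>
  define w where "w x i a =
    (if a \<in> A i then (x (i, a) + max 0 (1 - T x i) / card (A i)) / max 1 (T x i) else 0)" for x i a
  define S where "S x i = embed_pmf (w x i)" for x i
  have finAN: "finite (A i)" "card (A i) > 0" if "i \<in> N" for i
    using finA ND ne that by (auto simp: card_gt_0_iff)
  have w_nonneg: "w x i a \<ge> 0" if "x \<in> C" "i \<in> N" for x i a
    using that by (auto simp: w_def C_def Pi_iff)
  have w_sum: "(\<Sum>a\<in>A i. w x i a) = 1" if "i \<in> N" for x i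
  proof -
    have "(\<Sum>a\<in>A i. w x i a) = (T x i + max 0 (1 - T x i)) / max 1 (T x i)"
      using finAN[OF that] ne[OF that] by (simp add: w_def T_def sum.distrib flip: sum_divide_distrib)
    also have "\<dots> = 1" by (auto simp: max_def)
    finally show ?thesis .
  qed
  have pmf_S: "pmf (S x i) a = w x i a" if "x \<in> C" "i \<in> N" for x i a
    unfolding S_def
  proof (rule pmf_embed_pmf)
    have "(\<integral>\<^sup>+a. ennreal (w x i a) \<partial>count_space UNIV) = (\<Sum>a\<in>A i. ennreal (w x i a))"
      using finAN(1)[OF that(2)] by (intro nn_integral_count_space') (auto simp: w_def)
    also have "\<dots> = 1"
      using w_nonneg[OF that] w_sum[OF that(2)] by (subst sum_ennreal) auto
    finally show "(\<integral>\<^sup>+a. ennreal (w x i a) \<partial>count_space UNIV) = 1" .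
  qed (use w_nonneg[OF that] in auto)
  have set_S: "set_pmf (S x i) \<subseteq> A i" if "x \<in> C" "i \<in> N" for x i
    using pmf_S[OF that] by (auto simp: set_pmf_eq w_def)
  have cont_x: "continuous_on C (\<lambda>x. x k)" for k
    by (rule continuous_on_subset[OF continuous_on_product_coordinates]) simp
  have "continuous_on C (\<lambda>x. w x i a)" if "i \<in> N" for i a
    unfolding w_def T_def by (cases "a \<in> A i") (use finAN[OF that] in \<open>auto intro!: continuous_intros cont_x simp: ne that\<close>)
  then have cont_S: "continuous_on C (\<lambda>x. pmf (S x i) a)" if "i \<in> N" for i a
    using that by (simp add: pmf_S cong: continuous_on_cong)
  \<comment> \<open>Improvement by the pure deviation to \<open>a\<close>, cut off at 0; the cut-off
    keeps it continuous.\<close>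
  define gain where "gain x i a = max 0 (V ((S x)(i := return_pmf a)) i - V (S x) i)" for x i a
  define H where "H x i = (\<Sum>a\<in>A i. gain x i a)" for x i
  have cont_move: "continuous_on C (\<lambda>x. pmf (override_on q (S x) N v) a)"
    and set_move: "x \<in> C \<Longrightarrow> set_pmf (override_on q (S x) N v) \<subseteq> A v" if "v \<in> D" for v a x
    using cont_S set_S q that by (cases "v \<in> N"; simp)+
  have override_upd: "override_on q (s(i := p)) N = (override_on q s N)(i := p)" if "i \<in> N" for s i p
    using that by (auto simp: override_on_def)
  have cont_V: "continuous_on C (\<lambda>x. V (S x) i)" for i
    unfolding V_def
    by (intro continuous_on_expectation_Pi_pmf[where A = A] finD finA cont_move set_move)
  have cont_V': "continuous_on C (\<lambda>x. V ((S x)(i := return_pmf a)) i)" if "i \<in> N" "a \<in> A i" for i a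
    unfolding V_def override_upd[OF that(1)]
  proof (rule continuous_on_expectation_Pi_pmf[where A = A, OF finD finA])
    fix v b assume "v \<in> D"
    then show "continuous_on C (\<lambda>x. pmf (((override_on q (S x) N)(i := return_pmf a)) v) b)"
      using cont_move by (cases "v = i") simp_all
  qed (use set_move that(2) in auto)
  have cont_gain: "continuous_on C (\<lambda>x. gain x i a)" if "i \<in> N" "a \<in> A i" for i a
    unfolding gain_def using that by (intro continuous_intros cont_V cont_V')
  have cont_H: "continuous_on C (\<lambda>x. H x i)" if "i \<in> N" for i
    unfolding H_def using that by (intro continuous_intros cont_gain)
  have gain_nonneg: "gain x i a \<ge> 0" for x i a by (simp add: gain_def)
  have H_nonneg: "H x i \<ge> 0" for x i by (simp add: H_def gain_nonneg sum_nonneg)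
  \<comment> \<open>Nash's map, precomposed with the retraction \<open>S\<close> of the cube onto
    the strategy profiles.\<close>
  define f where "f x = (\<lambda>(i, a). (pmf (S x i) a + gain x i a) / (1 + H x i))" for x
  have f_eq: "f x (i, a) = (pmf (S x i) a + gain x i a) / (1 + H x i)" for x i a
    by (simp add: f_def)
  have "\<exists>x\<in>C. \<forall>k\<in>Sigma N A. f x k = x k"
    unfolding C_def
  proof (rule brouwer_finite_cube)
    show "finite (Sigma N A)"
      using finD ND finA by (intro finite_SigmaI) (auto intro: finite_subset)
  next
    fix x k assume "k \<in> Sigma N A"
    then obtain i a where k: "k = (i, a)" "i \<in> N" "a \<in> A i" by auto
    have "gain x i a \<le> H x i"
      unfolding H_def using finAN(1)[OF k(2)] k(3) gain_nonneg by (intro member_le_sum) auto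
    then have "pmf (S x i) a + gain x i a \<le> 1 + H x i"
      by (intro add_mono pmf_le_1)
    then show "f x k \<in> {0..1}"
      using gain_nonneg[of x i a] H_nonneg[of x i] by (auto simp: f_eq k(1) divide_simps)
  next
    fix k assume "k \<in> Sigma N A"
    then obtain i a where k: "k = (i, a)" "i \<in> N" "a \<in> A i" by auto
    have "1 + H x i \<noteq> 0" for x using H_nonneg[of x i] by linarith
    then have "continuous_on C (\<lambda>x. f x k)"
      unfolding k(1) f_eq by (intro continuous_intros cont_S cont_gain cont_H k) auto
    then show "continuous_on (Pi (Sigma N A) (\<lambda>_. {0..1})) (\<lambda>x. f x k)"
      by (simp add: C_def)
  qed
  then obtain x where xC: "x \<in> C" and fx: "\<And>i a. i \<in> N \<Longrightarrow> a \<in> A i \<Longrightarrow> f x (i, a) = x (i, a)"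
    by blast
  have V_upd: "V ((S x)(i := p)) i = (\<Sum>a\<in>A i. pmf p a * V ((S x)(i := return_pmf a)) i)"
    if "i \<in> N" "set_pmf p \<subseteq> A i" for i p
    using that ND unfolding V_def override_upd[OF that(1)]
    by (intro expectation_Pi_pmf_upd finD finA set_move[OF _ xC]) auto
  have best: "V ((S x)(i := return_pmf a)) i \<le> V (S x) i" if i: "i \<in> N" and a: "a \<in> A i" for i a
  proof -
    define P where "P a = pmf (S x i) a" for a
    have sum_P: "(\<Sum>a\<in>A i. P a) = 1"
      using w_sum[OF i] pmf_S[OF xC i] by (simp add: P_def)
    have fixed: "x (i, a) * (1 + H x i) = P a + gain x i a" if "a \<in> A i" for a
      using fx[OF i that] H_nonneg[of x i] by (auto simp: f_eq P_def divide_simps split: if_splits)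
    \<comment> \<open>Summing the fixed point equations over the actions shows that \<open>x\<close>
      already lies in the simplex at \<open>i\<close>, where the retraction is the identity.\<close>
    have "T x i * (1 + H x i) = (\<Sum>a\<in>A i. P a + gain x i a)"
      unfolding T_def sum_distrib_right by (intro sum.cong refl fixed)
    also have "\<dots> = 1 * (1 + H x i)"
      using sum_P by (simp add: sum.distrib H_def)
    finally have "T x i = 1"
      using H_nonneg[of x i] by (subst (asm) mult_right_cancel) auto
    then have "P a = x (i, a)" if "a \<in> A i" for a
      using that by (simp add: P_def pmf_S[OF xC i] w_def)
    then have gain_eq: "gain x i a = P a * H x i" if "a \<in> A i" for a
      using fixed[OF that] that by (simp add: algebra_simps)
    \<comment> \<open>If \<open>P a\<close> and \<open>H x i\<close> are positive, so is the gain,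
      and the cut-off is inactive; if \<open>P a = 0\<close>, both sides vanish.\<close>
    have "P a * gain x i a = P a * V ((S x)(i := return_pmf a)) i - P a * V (S x) i"
      if "a \<in> A i" "H x i > 0" for a
    proof (cases "P a = 0")
      case False
      then have "gain x i a > 0"
        using gain_eq[OF that(1)] that(2) pmf_nonneg[of "S x i" a] by (simp add: P_def)
      then show ?thesis by (simp add: gain_def max_def algebra_simps split: if_splits)
    qed simp
    \<comment> \<open>The pure deviations averaged with the weights \<open>P\<close> give back the
      current payoff, so the weighted gains cancel.\<close>
    then have "(\<Sum>a\<in>A i. P a * gain x i a) = V ((S x)(i := S x i)) i - (\<Sum>a\<in>A i. P a) * V (S x) i"
      if "H x i > 0"
      using V_upd[OF i set_S[OF xC i]] that
      by (simp add: sum_subtractf sum_distrib_right P_def)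
    then have zero: "(\<Sum>a\<in>A i. P a * gain x i a) = 0" if "H x i > 0"
      using that sum_P by simp
    have "H x i = 0"
    proof (rule ccontr)
      assume "H x i \<noteq> 0"
      then have pos: "H x i > 0" using H_nonneg[of x i] by simp
      have "\<forall>a\<in>A i. P a * gain x i a = 0"
        using zero[OF pos] gain_nonneg finAN(1)[OF i]
        by (subst (asm) sum_nonneg_eq_0_iff) (auto simp: P_def)
      \<comment> \<open>Each summand equals \<open>P a * P a * H x i\<close>.\<close>
      then have "\<forall>a\<in>A i. P a = 0"
        using gain_eq pos by auto
      then show False using sum_P by simp
    qed
    then have "gain x i a = 0" using gain_eq[OF a] by simp
    then show ?thesis by (simp add: gain_def max_def split: if_splits)
  qed
  have "V ((S x)(i := p)) i \<le> V (S x) i" if i: "i \<in> N" and p: "set_pmf p \<subseteq> A i" for i p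
  proof -
    \<comment> \<open>A mixed deviation pays a convex combination of what the pure ones pay.\<close>
    have "(\<Sum>a\<in>A i. pmf p a * V ((S x)(i := return_pmf a)) i) \<le> (\<Sum>a\<in>A i. pmf p a * V (S x) i)"
      by (intro sum_mono mult_left_mono best i) auto
    also have "\<dots> = V (S x) i"
      using sum_pmf_eq_1[OF finAN(1)[OF i] p] by (simp flip: sum_distrib_right)
    finally show ?thesis using V_upd[OF i p] by simp
  qed
  then show ?thesis using set_S[OF xC] by blast
qed

section \<open>Play-once graphical games in normal form\<close>

text \<open>Each player owns exactly one position, so \<open>pos\<close> identifies players with the
  non-chance, non-terminal positions, and chance takes the role of nature.\<close>

theorem mainTheorem7:
  fixes \<Gamma> :: "('v, 'e) game"
  assumes "graphical_game \<Gamma>"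
    and "play_once \<Gamma>"
  shows "\<exists>s. nash_equilibrium \<Gamma> s"
proof -
  define D where "D = verts (graph \<Gamma>) - terminals \<Gamma>"
  define N where "N = D - chance \<Gamma>"
  define A where "A = out_arcs (graph \<Gamma>)"
  define pos where "pos i = the_elem (controlled \<Gamma> i)" for i
  interpret fin_digraph "graph \<Gamma>"
    using assms(1) by (simp add: graphical_game_def)
  have verts: "verts (graph \<Gamma>) = (\<Union>i\<in>players \<Gamma>. controlled \<Gamma> i) \<union> chance \<Gamma> \<union> terminals \<Gamma>"
    and disj: "disjoint_family_on (controlled \<Gamma>) (players \<Gamma>)"
    and disj': "\<And>i. i \<in> players \<Gamma> \<Longrightarrow> controlled \<Gamma> i \<inter> chance \<Gamma> = {}"
      "\<And>i. i \<in> players \<Gamma> \<Longrightarrow> controlled \<Gamma> i \<inter> terminals \<Gamma> = {}"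
    and chance: "\<And>v. v \<in> chance \<Gamma> \<Longrightarrow> set_pmf (chance_dist \<Gamma> v) \<subseteq> A v"
    using assms(1) by (auto simp: graphical_game_def A_def)
  have single: "controlled \<Gamma> i = {pos i}" if i: "i \<in> players \<Gamma>" for i
    using assms(2) that by (auto simp: play_once_def pos_def card_1_singleton_iff)
  have pos: "pos i \<in> N" if "i \<in> players \<Gamma>" for i
    using that single[OF that] disj'[OF that] verts by (auto simp: N_def D_def)
  have controller_pos: "controller \<Gamma> (pos i) = i" if "i \<in> players \<Gamma>" for i
    unfolding controller_def
    using that single disj by (intro the_equality) (auto simp: disjoint_family_on_def)
  have N_eq: "N = pos ` players \<Gamma>"
  proof
    show "N \<subseteq> pos ` players \<Gamma>" using verts single by (auto simp: N_def D_def)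
  qed (use pos in auto)
  \<comment> \<open>Strategies are indexed here by positions; a position receives the payoff of its
    controller.\<close>
  define V where "V s v = measure_pmf.expectation (Pi_pmf D undefined (override_on (chance_dist \<Gamma>) s N))
      (\<lambda>\<sigma>. payoff \<Gamma> (controller \<Gamma> v) (play_outcome \<Gamma> \<sigma>))" for s v
  have "\<exists>s. (\<forall>v\<in>N. set_pmf (s v) \<subseteq> A v) \<and>
      (\<forall>v\<in>N. \<forall>p. set_pmf p \<subseteq> A v \<longrightarrow> V (s(v := p)) v \<le> V s v)"
    unfolding V_def
  proof (rule mixed_equilibrium_exists)
    show "set_pmf (chance_dist \<Gamma> v) \<subseteq> A v" if "v \<in> D - N" for v
      using that chance by (auto simp: N_def)
  \<comment> \<open>Action sets are nonempty because a position without outgoing arcs is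
    terminal.\<close>
  qed (auto simp: N_def D_def A_def terminals_def)
  then obtain s where "\<forall>v\<in>N. set_pmf (s v) \<subseteq> A v"
      "\<forall>v\<in>N. \<forall>p. set_pmf p \<subseteq> A v \<longrightarrow> V (s(v := p)) v \<le> V s v"
    by (elim exE conjE)
  note s = this(1)[rule_format] and best = this(2)[rule_format]
  \<comment> \<open>Translates between profiles indexed by players and by positions, for equilibrium
    and deviation alike.\<close>
  have payoff_eq: "expected_payoff \<Gamma> t i =
      measure_pmf.expectation (Pi_pmf D undefined (override_on (chance_dist \<Gamma>) t' N))
        (\<lambda>\<sigma>. payoff \<Gamma> i (play_outcome \<Gamma> \<sigma>))"
    if "\<And>j. j \<in> players \<Gamma> \<Longrightarrow> t j = t' (pos j)" for t t' i
  proof -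
    have "apriori_moves \<Gamma> t = Pi_pmf D undefined (override_on (chance_dist \<Gamma>) t' N)"
      unfolding apriori_moves_def
    proof (rule Pi_pmf_cong)
      fix v assume "v \<in> verts (graph \<Gamma>) - terminals \<Gamma>"
      then have v: "v \<in> D" by (simp add: D_def)
      show "move_dist \<Gamma> t v = override_on (chance_dist \<Gamma>) t' N v"
      proof (cases "v \<in> chance \<Gamma>")
        case True
        then show ?thesis by (simp add: move_dist_def N_def)
      next
        case False
        then have "v \<in> N" using v by (simp add: N_def)
        then obtain j where "j \<in> players \<Gamma>" "v = pos j" using N_eq by blast
        then show ?thesis
          using False \<open>v \<in> N\<close> by (simp add: move_dist_def controller_pos that)
      qed
    qed (simp_all add: D_def)
    then show ?thesis by (simp add: expected_payoff_def)
  qed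
  have "nash_equilibrium \<Gamma> (\<lambda>i. s (pos i))"
    unfolding nash_equilibrium_def
  proof (intro conjI ballI allI impI)
    fix i assume i: "i \<in> players \<Gamma>"
    then show "mixed_strategy \<Gamma> i (s (pos i))"
      using s[OF pos[OF i]] by (simp add: mixed_strategy_def A_def pos_def)
    fix p assume "mixed_strategy \<Gamma> i p"
    then have p: "set_pmf p \<subseteq> A (pos i)" by (simp add: mixed_strategy_def A_def pos_def)
    \<comment> \<open>\<open>controller\<close> inverts \<open>pos\<close> on players, so
      \<open>pos\<close> is injective there and a deviation of \<open>i\<close> changes only the
      move at \<open>pos i\<close>.\<close>
    have "((\<lambda>i. s (pos i))(i := p)) j = (s(pos i := p)) (pos j)" if "j \<in> players \<Gamma>" for j
      using controller_pos[OF i] controller_pos[OF that] by auto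
    then show "\<not> expected_payoff \<Gamma> ((\<lambda>i. s (pos i))(i := p)) i > expected_payoff \<Gamma> (\<lambda>i. s (pos i)) i"
      using best[OF pos[OF i] p]
      by (simp add: V_def payoff_eq[of _ "s(pos i := p)"] payoff_eq[of _ s] controller_pos[OF i])
  qed
  then show ?thesis by blast
qed

end
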